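(* Let $D\subset\mathbb{R}^2$ be a bounded simply connected domain with $C^1$ boundary and barycenter at the origin. Assume that $\chi_D$ is a V-state with angular velocity $\Omega=\frac12$, i.e. there is a constant $\mu\in\mathbb{R}$ with $$\psi(x)-\tfrac14|x|^2=\mu\quad\text{for all }x\in\partial D,\qquad \psi(x)=\frac1{2\pi}\int_D\log|x-y|\,dy .$$ Then $D$ is a disc.
   Context: A V-state (rotating patch) for the 2D incompressible Euler equations is a domain $D$ such that the vortex patch $\omega_0=\chi_D$ evolves as $\omega(t)=\chi_{D_t}$ with $D_t$ the rotation of $D$ about its barycenter (taken to be $0$) by angle $\Omega t$; for a $C^1$ boundary this is equivalent to the condition that $\psi(x)-\frac12\Omega|x|^2$ is constant on $\partial D$, where $\psi$ is the stream function of $\chi_D$ given in the claim. *)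

theory Defs
  imports "HOL-Analysis.Analysis"
begin

text \<open>We identify the plane R^2 with the complex numbers; Lebesgue measure on complex
  is the planar Lebesgue measure.\<close>

definition stream_fun :: "complex set \<Rightarrow> complex \<Rightarrow> real" where
  "stream_fun D x = (1 / (2 * pi)) * integral D (\<lambda>y. ln (norm (x - y)))"

text \<open>C^1 boundary (standard local-graph definition): near every boundary point p,
  after a rigid motion (translation to p and a rotation), D coincides with the region
  strictly below the graph of a C^1 function f : R \<Rightarrow> R.\<close>
definition C1_boundary :: "complex set \<Rightarrow> bool" where
  "C1_boundary D \<longleftrightarrow>
     (\<forall>p \<in> frontier D. \<exists>r > 0. \<exists>\<theta> :: real. \<exists>f :: real \<Rightarrow> real.
        f C1_differentiable_on UNIV \<and> f 0 = 0 \<and>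
        D \<inter> ball p r = {x \<in> ball p r. Im (cis \<theta> * (x - p)) < f (Re (cis \<theta> * (x - p)))})"

definition barycenter_zero :: "complex set \<Rightarrow> bool" where
  "barycenter_zero D \<longleftrightarrow> integral D (\<lambda>y. y) = 0"

end

theory Submission
  imports Defs "HOL-Complex_Analysis.Complex_Analysis"
begin

text \<open>
  Since \<open>\<psi>\<close> and \<open>|x|\<^sup>2/4\<close> both have Laplacian 1 in \<open>D\<close>, their difference is harmonic there;
  being constant on the boundary, it is constant. Taking gradients, the Cauchy transform
  \<open>F z = \<integral>\<^sub>D dy / (z - y)\<close> equals \<open>\<pi> cnj z\<close> on \<open>D\<close>. Integrating \<open>z F z\<close> over \<open>D\<close> and symmetrizing
  the double integral of \<open>z / (z - y)\<close> gives \<open>2 \<pi> \<integral>\<^sub>D |z|\<^sup>2 = |D|\<^sup>2\<close>. The disc about the origin of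
  the same area satisfies the same identities, and among all sets of that area it alone, up to
  null sets, minimizes \<open>\<integral> |z|\<^sup>2\<close>. So \<open>D\<close> and the disc differ by a null set, and the regularity of
  the boundary removes the null set.
\<close>

section \<open>Lebesgue measure and singular integrals\<close>

lemma open_ae_countable_union_disjoint_balls:
  fixes U :: "'a::euclidean_space set"
  assumes "open U"
  obtains C :: "('a \<times> real) set" where "countable C" "\<forall>i\<in>C. 0 < snd i"
    and "disjoint_family_on (\<lambda>i. ball (fst i) (snd i)) C"
    and "(\<Union>i\<in>C. ball (fst i) (snd i)) \<subseteq> U"
    and "U - (\<Union>i\<in>C. ball (fst i) (snd i)) \<in> null_sets lborel"
proof -
  define K where "K = {(a, r). 0 < r \<and> ball a r \<subseteq> U}"
  have "\<exists>i. i \<in> K \<and> x \<in> ball (fst i) (snd i) \<and> snd i < d" if "x \<in> U" "0 < d" for x d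
  proof -
    obtain e where "e > 0" "ball x e \<subseteq> U" using assms \<open>x \<in> U\<close> openE by blast
    then have "(x, min e (d / 2)) \<in> K" using \<open>0 < d\<close> by (auto simp: K_def)
    then show ?thesis using \<open>e > 0\<close> \<open>0 < d\<close> by force
  qed
  then obtain C where "countable C" "C \<subseteq> K"
    and disjoint: "pairwise (\<lambda>i j. disjnt (ball (fst i) (snd i)) (ball (fst j) (snd j))) C"
    and null: "negligible (U - (\<Union>i\<in>C. ball (fst i) (snd i)))"
    by (rule Vitali_covering_theorem_balls[of U K fst snd])
  show ?thesis
  proof
    show "countable C" by fact
    show "\<forall>i\<in>C. 0 < snd i" using \<open>C \<subseteq> K\<close> by (auto simp: K_def)
    show "disjoint_family_on (\<lambda>i. ball (fst i) (snd i)) C"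
      using disjoint by (auto simp: disjoint_family_on_def pairwise_def disjnt_def)
    show "(\<Union>i\<in>C. ball (fst i) (snd i)) \<subseteq> U" using \<open>C \<subseteq> K\<close> unfolding K_def by fastforce
    have "U - (\<Union>i\<in>C. ball (fst i) (snd i)) \<in> sets borel"
      using assms by (intro sets.Diff borel_open open_UN) auto
    then show "U - (\<Union>i\<in>C. ball (fst i) (snd i)) \<in> null_sets lborel"
      using null by (simp add: negligible_iff_null_sets null_sets_completion_iff)
  qed
qed

lemma emeasure_lborel_orthogonal_image_ge:
  fixes f :: "'a::euclidean_space \<Rightarrow> 'a"
  assumes f: "orthogonal_transformation f" and "open U" and "f ` U \<in> sets borel"
  shows "emeasure lborel U \<le> emeasure lborel (f ` U)"
proof -
  obtain C :: "('a \<times> real) set" where "countable C" and radius: "\<forall>i\<in>C. 0 < snd i"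
    and disjoint: "disjoint_family_on (\<lambda>i. ball (fst i) (snd i)) C"
    and subset: "(\<Union>i\<in>C. ball (fst i) (snd i)) \<subseteq> U"
    and null: "U - (\<Union>i\<in>C. ball (fst i) (snd i)) \<in> null_sets lborel"
    by (rule open_ae_countable_union_disjoint_balls[OF \<open>open U\<close>])
  define B where "B = (\<lambda>i::'a \<times> real. ball (fst i) (snd i))"
  have image_B: "f ` B i = ball (f (fst i)) (snd i)" for i
    by (simp add: B_def image_orthogonal_transformation_ball[OF f])
  have disjoint_image: "disjoint_family_on (\<lambda>i. f ` B i) C"
    using disjoint orthogonal_transformation_inj[OF f]
    by (simp add: B_def disjoint_family_on_def image_Int[symmetric])
  have "U = (\<Union>i\<in>C. B i) \<union> (U - (\<Union>i\<in>C. B i))" using subset by (auto simp: B_def)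
  also have "emeasure lborel \<dots> = emeasure lborel (\<Union>i\<in>C. B i)"
    using null by (intro emeasure_Un_null_set) (auto simp: B_def intro: borel_open)
  also have "\<dots> = (\<integral>\<^sup>+i. emeasure lborel (B i) \<partial>count_space C)"
    using \<open>countable C\<close> disjoint by (intro emeasure_UN_countable) (auto simp: B_def)
  also have "\<dots> = (\<integral>\<^sup>+i. emeasure lborel (f ` B i) \<partial>count_space C)"
    using radius
    by (intro nn_integral_cong) (simp add: image_B, simp add: B_def emeasure_ball less_imp_le)
  also have "\<dots> = emeasure lborel (\<Union>i\<in>C. f ` B i)"
    using \<open>countable C\<close> disjoint_image by (intro emeasure_UN_countable[symmetric]) (auto simp: image_B)
  also have "\<dots> \<le> emeasure lborel (f ` U)"
    using subset assms(3) by (intro emeasure_mono) (auto simp: B_def)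
  finally show ?thesis .
qed

lemma lborel_distr_orthogonal:
  fixes f :: "'a::euclidean_space \<Rightarrow> 'a"
  assumes f: "orthogonal_transformation f"
  shows "distr lborel borel f = lborel"
proof (rule lborel_eqI[symmetric])
  fix l u :: 'a
  assume ordered: "\<And>b. b \<in> Basis \<Longrightarrow> l \<bullet> b \<le> u \<bullet> b"
  have continuous: "continuous_on UNIV f"
    using orthogonal_transformation_linear[OF f] by (rule linear_continuous_on_compose[OF continuous_on_id])
  have bij: "bij f" by (rule orthogonal_transformation_bij[OF f])
  define V where "V = f -` box l u"
  have V_eq: "V = inv f ` box l u" unfolding V_def using bij by (simp add: bij_vimage_eq_inv_image)
  have image_V: "f ` V = box l u"
    unfolding V_def using bij by (simp add: bij_is_surj surj_image_vimage_eq)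
  have "open V" unfolding V_def by (intro open_vimage open_box continuous)
  have "emeasure lborel V \<le> emeasure lborel (box l u)"
    using emeasure_lborel_orthogonal_image_ge[OF f \<open>open V\<close>] by (simp add: image_V)
  moreover have "emeasure lborel (box l u) \<le> emeasure lborel V"
    using emeasure_lborel_orthogonal_image_ge[OF orthogonal_transformation_inv[OF f] open_box, of l u]
      \<open>open V\<close> by (simp add: V_eq)
  ultimately have "emeasure lborel V = emeasure lborel (box l u)" by (rule antisym)
  then show "emeasure (distr lborel borel f) (box l u) = ennreal (\<Prod>b\<in>Basis. (u - l) \<bullet> b)"
    using borel_measurable_continuous_onI[OF continuous] ordered by (simp add: emeasure_distr V_def)
qed simp

lemma
  fixes f :: "'a::euclidean_space \<Rightarrow> 'b::{banach, second_countable_topology}"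
  assumes [measurable]: "f \<in> borel_measurable borel"
  shows integrable_lborel_translate: "integrable lborel (\<lambda>y. f (y - c)) \<longleftrightarrow> integrable lborel f"
    and integral_lborel_translate: "(LINT y|lborel. f (y - c)) = integral\<^sup>L lborel f"
proof -
  have shift: "distr lborel borel (\<lambda>y. - c + y) = lborel" by (rule lborel_distr_plus)
  have "integrable lborel f \<longleftrightarrow> integrable lborel (\<lambda>y. f (- c + y))"
    by (subst shift[symmetric], subst integrable_distr_eq) auto
  then show "integrable lborel (\<lambda>y. f (y - c)) \<longleftrightarrow> integrable lborel f" by simp
  have "integral\<^sup>L lborel f = (LINT y|lborel. f (- c + y))"
    by (subst shift[symmetric], subst integral_distr) auto
  then show "(LINT y|lborel. f (y - c)) = integral\<^sup>L lborel f" by simp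
qed

lemma nn_integral_cball_layers:
  fixes w :: "real \<Rightarrow> ennreal"
  assumes [measurable]: "w \<in> borel_measurable borel"
  shows "(\<lambda>y::'a::euclidean_space. \<integral>\<^sup>+s. w s * indicator (cball 0 s) y \<partial>lborel) \<in> borel_measurable borel"
    and "(\<integral>\<^sup>+y. (\<integral>\<^sup>+s. w s * indicator (cball 0 s) (y::'a) \<partial>lborel) \<partial>lborel)
      = (\<integral>\<^sup>+s. w s * emeasure lborel (cball (0::'a) s) \<partial>lborel)"
proof -
  have "(\<lambda>(y::'a, s). w s * indicator {p. norm (fst p) \<le> snd p} (y, s))
      \<in> borel_measurable (lborel \<Otimes>\<^sub>M lborel)"
    by measurable
  then have pair_measurable: "(\<lambda>(y::'a, s). w s * indicator (cball 0 s) y)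
      \<in> borel_measurable (lborel \<Otimes>\<^sub>M lborel)"
    by (rule measurable_cong[THEN iffD1, rotated]) (auto simp: indicator_def)
  then show "(\<lambda>y::'a. \<integral>\<^sup>+s. w s * indicator (cball 0 s) y \<partial>lborel) \<in> borel_measurable borel"
    using lborel.borel_measurable_nn_integral[OF pair_measurable] by simp
  show "(\<integral>\<^sup>+y. (\<integral>\<^sup>+s. w s * indicator (cball 0 s) (y::'a) \<partial>lborel) \<partial>lborel)
      = (\<integral>\<^sup>+s. w s * emeasure lborel (cball (0::'a) s) \<partial>lborel)"
    by (simp add: lborel_pair.Fubini'[OF pair_measurable, symmetric] nn_integral_cmult_indicator)
qed

lemma nn_integral_powr_layers:
  fixes a t :: real
  assumes "0 < a" "0 < t" "t \<le> 1"
  shows "(\<integral>\<^sup>+s. ennreal (a * s powr (- a - 1)) * indicator {t..1} s \<partial>lborel) = ennreal (t powr - a - 1)"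
proof -
  have "(\<integral>\<^sup>+s. ennreal (a * s powr (- a - 1)) * indicator {t..1} s \<partial>lborel)
      = ennreal (- (1 powr - a) - (- (t powr - a)))"
    using assms by (intro nn_integral_FTC_Icc) (auto intro!: derivative_eq_intros)
  then show ?thesis by simp
qed

lemma norm_powr_le_cball_layers:
  fixes a :: real and y :: "'a::euclidean_space"
  assumes "0 < a" "norm y < 1"
  shows "ennreal (norm y powr - a)
    \<le> 1 + (\<integral>\<^sup>+s. ennreal (a * s powr (- a - 1)) * indicator {0<..1} s * indicator (cball 0 s) y \<partial>lborel)"
proof (cases "y = 0")
  case False
  then have pos: "0 < s" if "norm y \<le> s" for s
    using that norm_ge_zero[of y] by (metis norm_eq_zero less_eq_real_def order_less_le_trans)
  have "(\<integral>\<^sup>+s. ennreal (a * s powr (- a - 1)) * indicator {0<..1} s * indicator (cball 0 s) y \<partial>lborel)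
      = (\<integral>\<^sup>+s. ennreal (a * s powr (- a - 1)) * indicator {norm y..1} s \<partial>lborel)"
    using pos by (intro nn_integral_cong) (auto simp: indicator_def)
  also have "\<dots> = ennreal (norm y powr - a - 1)"
    using False assms by (intro nn_integral_powr_layers) auto
  finally show ?thesis
    using False assms powr_mono2'[of "- a" "norm y" 1] by (simp flip: ennreal_1 ennreal_plus)
qed simp

lemma integrable_norm_powr_unit_ball:
  fixes a :: real
  assumes a: "0 < a" "a < DIM('a::euclidean_space)"
  shows "integrable lborel (\<lambda>y::'a. indicator (ball 0 1) y * norm y powr - a)"
proof (rule integrableI_bounded)
  let ?n = "DIM('a)" and ?v = "unit_ball_vol (DIM('a))"
  define w where "w = (\<lambda>s. ennreal (a * s powr (- a - 1)) * indicator {0<..1} s)"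
  have [measurable]: "w \<in> borel_measurable borel" unfolding w_def by measurable
  have "w s * emeasure lborel (cball (0::'a) s)
      = ennreal (a * ?v) * (ennreal (s powr (?n - a - 1)) * indicator {0..1} s)" for s
  proof (cases "s \<in> {0<..1}")
    case True
    then have "s powr (- a - 1) * s ^ ?n = s powr (?n - a - 1)"
      by (simp add: powr_realpow[symmetric] powr_add[symmetric] algebra_simps)
    then show ?thesis using True a
      by (simp add: w_def emeasure_cball ennreal_mult'[symmetric] mult_ac)
  qed (auto simp: w_def indicator_def)
  then have "(\<integral>\<^sup>+s. w s * emeasure lborel (cball (0::'a) s) \<partial>lborel)
      = ennreal (a * ?v) * ennreal (1 / (?n - a))"
    using nn_integral_has_integral_lebesgue'[OF _ has_integral_powr_from_0[of "?n - a - 1" 1]] a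
    by (simp add: nn_integral_cmult)
  then have "(\<integral>\<^sup>+y. (\<integral>\<^sup>+s. w s * indicator (cball 0 s) (y::'a) \<partial>lborel) \<partial>lborel) < \<infinity>"
    by (simp add: nn_integral_cball_layers ennreal_mult_less_top)
  then have "(\<integral>\<^sup>+y. indicator (ball 0 1) (y::'a)
      + (\<integral>\<^sup>+s. w s * indicator (cball 0 s) y \<partial>lborel) \<partial>lborel) < \<infinity>"
    by (subst nn_integral_add)
      (simp_all add: emeasure_ball nn_integral_cball_layers(1) borel_measurable_indicator)
  moreover have "ennreal (norm (indicator (ball 0 1) y * norm y powr - a))
      \<le> indicator (ball 0 1) y + (\<integral>\<^sup>+s. w s * indicator (cball 0 s) y \<partial>lborel)" for y :: 'a
    using norm_powr_le_cball_layers[OF a(1), of y] by (cases "norm y < 1") (simp_all add: w_def)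
  ultimately show "(\<integral>\<^sup>+y. ennreal (norm (indicator (ball 0 1) y * norm (y::'a) powr - a)) \<partial>lborel) < \<infinity>"
    by (rule le_less_trans[OF nn_integral_mono, rotated])
qed (auto intro!: borel_measurable_times borel_measurable_indicator)

section \<open>Bounded densities of bounded support\<close>

definition bdd_density :: "('a::euclidean_space \<Rightarrow> 'b::{banach, second_countable_topology}) \<Rightarrow> bool" where
  "bdd_density g \<longleftrightarrow> g \<in> borel_measurable borel \<and> bounded (range g) \<and> bounded {y. g y \<noteq> 0}"

lemma borel_measurable_bdd_density [measurable_dest]: "bdd_density g \<Longrightarrow> g \<in> borel_measurable borel"
  by (simp add: bdd_density_def)

lemma bdd_densityE:
  assumes "bdd_density g"
  obtains B M where "B > 0" "M > 0" "\<And>y. norm (g y) \<le> B * indicator (ball 0 M) y"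
proof -
  obtain B where B: "B > 0" "\<And>y. norm (g y) \<le> B"
    using assms unfolding bdd_density_def bounded_pos by auto
  obtain M where M: "M > 0" "\<And>y. g y \<noteq> 0 \<Longrightarrow> norm y \<le> M"
    using assms unfolding bdd_density_def bounded_pos by auto
  have "norm (g y) \<le> B * indicator (ball 0 (M + 1)) y" for y
    using B(2)[of y] M(2)[of y] by (cases "g y = 0") (auto simp: indicator_def)
  with B(1) M(1) show ?thesis by (intro that[of B "M + 1"]) auto
qed

lemma bdd_density_indicator:
  fixes A :: "'a::euclidean_space set"
  assumes "A \<in> sets borel" "bounded A"
  shows "bdd_density (indicator A :: 'a \<Rightarrow> 'b::{banach, second_countable_topology, real_normed_algebra_1})"
  unfolding bdd_density_def
proof (intro conjI)
  show "indicator A \<in> borel_measurable borel" using assms(1) by simp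
  show "bounded (range (indicator A :: 'a \<Rightarrow> 'b))"
    by (rule boundedI[of _ 1]) (auto simp: indicator_def)
  show "bounded {y. indicator A y \<noteq> (0::'b)}"
    using assms(2) by (rule bounded_subset) (auto simp: indicator_def)
qed

lemma bdd_density_mult:
  fixes f g :: "'a::euclidean_space \<Rightarrow> 'b::{banach, second_countable_topology, real_normed_algebra}"
  assumes g: "bdd_density g" and f: "f \<in> borel_measurable borel" and L: "\<And>y. g y \<noteq> 0 \<Longrightarrow> norm (f y) \<le> L"
  shows "bdd_density (\<lambda>y. f y * g y)"
  unfolding bdd_density_def
proof (intro conjI)
  show "(\<lambda>y. f y * g y) \<in> borel_measurable borel" using f g by measurable
  obtain B where B: "B > 0" "\<And>y. norm (g y) \<le> B"
    using g unfolding bdd_density_def bounded_pos by auto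
  have "norm (f y * g y) \<le> \<bar>L\<bar> * B" for y
  proof (cases "g y = 0")
    case False
    have "norm (f y) * norm (g y) \<le> \<bar>L\<bar> * B" using L[OF False] B(2)[of y] by (intro mult_mono) auto
    then show ?thesis using norm_mult_ineq order_trans by blast
  qed (use B in auto)
  then show "bounded (range (\<lambda>y. f y * g y))" by (intro boundedI[of _ "\<bar>L\<bar> * B"]) auto
  have "bounded {y. g y \<noteq> 0}" using g by (simp add: bdd_density_def)
  then show "bounded {y. f y * g y \<noteq> 0}" by (rule bounded_subset) auto
qed

lemma bdd_density_times_ident:
  fixes g :: "complex \<Rightarrow> complex"
  assumes "bdd_density g"
  shows "bdd_density (\<lambda>y. y * g y)"
proof -
  obtain M where "\<And>y. g y \<noteq> 0 \<Longrightarrow> norm y \<le> M"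
    using assms unfolding bdd_density_def bounded_pos by auto
  then show ?thesis using assms by (intro bdd_density_mult[of _ _ M]) auto
qed

lemma bdd_density_of_real:
  assumes "bdd_density g"
  shows "bdd_density (\<lambda>y. of_real (g y) :: 'b::{banach, second_countable_topology, real_normed_div_algebra})"
  unfolding bdd_density_def
proof (intro conjI)
  show "(\<lambda>y. of_real (g y) :: 'b) \<in> borel_measurable borel" using assms by measurable
  show "bounded (range (\<lambda>y. of_real (g y) :: 'b))" "bounded {y. (of_real (g y) :: 'b) \<noteq> 0}"
    using assms by (simp_all add: bdd_density_def bounded_iff)
qed

lemma integrable_bdd_density:
  assumes "bdd_density g"
  shows "integrable lborel g"
proof -
  obtain B M where B: "B > 0" "\<And>y. norm (g y) \<le> B * indicator (ball 0 M) y"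
    using bdd_densityE[OF assms] by metis
  show ?thesis
  proof (rule Bochner_Integration.integrable_bound)
    show "integrable lborel (\<lambda>y::'a. B * indicator (ball 0 M) y)"
      by (intro integrable_mult_right integrable_real_indicator)
        (auto simp: emeasure_lborel_ball_finite[unfolded infinity_ennreal_def])
    show "AE y in lborel. norm (g y) \<le> norm (B * indicator (ball 0 M) y)"
      using B by (intro AE_I2) (auto simp: abs_mult)
  qed (use assms in measurable)
qed

lemma bdd_density_riesz_potential:
  fixes g :: "'a::euclidean_space \<Rightarrow> 'b::{banach, second_countable_topology}" and a :: real
  assumes g: "bdd_density g" and a: "0 < a" "a < DIM('a)"
  shows "integrable lborel (\<lambda>y. norm (x - y) powr - a * norm (g y))"
    and "\<exists>K. \<forall>x. (LINT y|lborel. norm (x - y) powr - a * norm (g y)) \<le> K"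
proof -
  obtain B where B: "B > 0" "\<And>y. norm (g y) \<le> B"
    using g unfolding bdd_density_def bounded_pos by auto
  define s where "s = (\<lambda>y::'a. indicator (ball 0 1) y * norm y powr - a)"
  have s_integrable: "integrable lborel s"
    unfolding s_def by (rule integrable_norm_powr_unit_ball[OF a])
  then have s_measurable: "s \<in> borel_measurable borel" by auto
  define h where "h = (\<lambda>x y. B * s (y - x) + norm (g y))"
  have h_bound: "norm (x - y) powr - a * norm (g y) \<le> h x y" for x y
  proof (cases "norm (x - y) < 1")
    case True
    then have "norm (x - y) powr - a * norm (g y) \<le> s (y - x) * B"
      using B(2) by (intro mult_mono) (auto simp: s_def norm_minus_commute)
    then show ?thesis unfolding h_def by (simp add: mult.commute add_increasing2)
  next
    case False
    then have "norm (x - y) powr - a \<le> 1" using a powr_mono2'[of "- a" 1 "norm (x - y)"] by simp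
    then have "norm (x - y) powr - a * norm (g y) \<le> norm (g y)" by (simp add: mult_left_le_one_le)
    moreover have "0 \<le> B * s (y - x)" using B(1) by (simp add: s_def)
    ultimately show ?thesis unfolding h_def by linarith
  qed
  have h_integrable: "integrable lborel (h x)" for x
    unfolding h_def using s_integrable s_measurable integrable_bdd_density[OF g]
    by (simp add: integrable_lborel_translate)
  show integrable: "integrable lborel (\<lambda>y. norm (x - y) powr - a * norm (g y))" for x
  proof (rule Bochner_Integration.integrable_bound[OF h_integrable[of x]])
    have "norm (norm (x - y) powr - a * norm (g y)) \<le> norm (h x y)" for y
      using order_trans[OF h_bound[of x y] abs_ge_self] by (simp add: abs_mult)
    then show "AE y in lborel. norm (norm (x - y) powr - a * norm (g y)) \<le> norm (h x y)" by simp
  qed (use g in measurable)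
  have "integral\<^sup>L lborel (h x) = B * integral\<^sup>L lborel s + (LINT y|lborel. norm (g y))" for x
    unfolding h_def using s_integrable s_measurable integrable_bdd_density[OF g]
    by (simp add: integrable_lborel_translate integral_lborel_translate)
  then have "(LINT y|lborel. norm (x - y) powr - a * norm (g y))
      \<le> B * integral\<^sup>L lborel s + (LINT y|lborel. norm (g y))" for x
    using integral_mono[OF integrable h_integrable h_bound] by metis
  then show "\<exists>K. \<forall>x. (LINT y|lborel. norm (x - y) powr - a * norm (g y)) \<le> K"
    by (intro exI[of _ "B * integral\<^sup>L lborel s + (LINT y|lborel. norm (g y))"] allI)
qed

section \<open>The Cauchy transform\<close>

definition cauchy_transform :: "(complex \<Rightarrow> complex) \<Rightarrow> complex \<Rightarrow> complex" where
  "cauchy_transform g z = (LINT y|lborel. inverse (z - y) * g y)"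

lemma norm_cauchy_kernel:
  fixes g :: "complex \<Rightarrow> complex"
  shows "norm (inverse (z - y) * g y) = norm (z - y) powr - 1 * norm (g y)"
  by (simp add: norm_mult norm_inverse powr_minus)

lemma integrable_cauchy_kernel:
  fixes g :: "complex \<Rightarrow> complex"
  assumes g: "bdd_density g"
  shows "integrable lborel (\<lambda>y. inverse (z - y) * g y)"
proof (rule integrable_norm_cancel)
  show "integrable lborel (\<lambda>y. norm (inverse (z - y) * g y))"
    unfolding norm_cauchy_kernel by (intro bdd_density_riesz_potential g) simp_all
qed (use g in measurable)

lemma integral_norm_cauchy_kernel_bounded:
  fixes g :: "complex \<Rightarrow> complex"
  assumes g: "bdd_density g"
  shows "\<exists>K. \<forall>z. (LINT y|lborel. norm (inverse (z - y) * g y)) \<le> K"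
  unfolding norm_cauchy_kernel by (intro bdd_density_riesz_potential g) simp_all

text \<open>The exponent \<open>- 3/2\<close> is integrable at the origin of the plane. As \<open>inverse 0 = 0\<close> and
  \<open>0 powr x = 0\<close>, the estimate also holds for \<open>u = 0\<close> or \<open>v = 0\<close>.\<close>
lemma norm_inverse_diff_le:
  fixes u v :: "'a::real_normed_field"
  shows "norm (inverse u - inverse v)
    \<le> sqrt (norm (u - v)) * (norm u powr - (3/2) + norm v powr - (3/2))"
proof -
  define p q where "p = inverse (sqrt (norm u))" and "q = inverse (sqrt (norm v))"
  have p_cube: "norm u powr - (3/2) = p ^ 3" and q_cube: "norm v powr - (3/2) = q ^ 3"
    by (simp_all add: p_def q_def powr_minus powr_half_sqrt[symmetric] powr_powr power_inverse
        flip: powr_realpow')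
  show ?thesis
  proof (cases "u = 0 \<or> v = 0")
    case True
    have "sqrt t * inverse (sqrt t) ^ 3 = inverse t" if "t \<ge> 0" for t
      using that by (cases "t = 0") (simp_all add: power3_eq_cube field_simps)
    then show ?thesis
      unfolding p_cube q_cube using True by (auto simp: p_def q_def norm_inverse)
  next
    case False
    then have pq: "p > 0" "q > 0" "inverse (norm u) = p\<^sup>2" "inverse (norm v) = q\<^sup>2"
      "sqrt (norm u) * p = 1" "sqrt (norm v) * q = 1"
      by (simp_all add: p_def q_def power_inverse)
    have "sqrt (norm (u - v)) \<le> sqrt (norm u + norm v)" by (simp add: norm_triangle_ineq4)
    also have "\<dots> \<le> sqrt (norm u) + sqrt (norm v)" by (rule sqrt_add_le_add_sqrt) auto
    finally have "sqrt (norm (u - v)) * sqrt (norm (u - v)) * (p\<^sup>2 * q\<^sup>2)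
        \<le> sqrt (norm (u - v)) * (sqrt (norm u) + sqrt (norm v)) * (p\<^sup>2 * q\<^sup>2)"
      by (intro mult_right_mono mult_left_mono) auto
    also have "\<dots> = sqrt (norm (u - v)) * ((sqrt (norm u) * p) * p * q\<^sup>2 + (sqrt (norm v) * q) * q * p\<^sup>2)"
      by (simp add: algebra_simps power2_eq_square)
    also have "\<dots> = sqrt (norm (u - v)) * (p * q\<^sup>2 + q * p\<^sup>2)"
      unfolding pq by simp
    also have "\<dots> \<le> sqrt (norm (u - v)) * (p ^ 3 + q ^ 3)"
    proof -
      have "p ^ 3 + q ^ 3 - (p * q\<^sup>2 + q * p\<^sup>2) = (p + q) * (p - q)\<^sup>2" by algebra
      moreover have "(p + q) * (p - q)\<^sup>2 \<ge> 0" using pq by simp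
      ultimately show ?thesis by (intro mult_left_mono) auto
    qed
    finally show ?thesis using False
      by (simp add: p_cube q_cube inverse_diff_inverse norm_mult norm_inverse pq(3,4)
          norm_minus_commute mult_ac)
  qed
qed

lemma cauchy_transform_hoelder:
  assumes g: "bdd_density g"
  obtains C where "\<And>z w. norm (cauchy_transform g z - cauchy_transform g w) \<le> C * sqrt (norm (z - w))"
proof -
  let ?k = "\<lambda>z y. norm (z - y) powr - (3/2) * norm (g y)"
  have k_integrable: "integrable lborel (?k z)" for z
    by (intro bdd_density_riesz_potential g) simp_all
  obtain K where K: "\<And>z. integral\<^sup>L lborel (?k z) \<le> K"
    using bdd_density_riesz_potential(2)[OF g, of "3/2"] by auto
  have "norm (cauchy_transform g z - cauchy_transform g w) \<le> 2 * K * sqrt (norm (z - w))" for z w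
  proof -
    have "cauchy_transform g z - cauchy_transform g w
        = (LINT y|lborel. inverse (z - y) * g y - inverse (w - y) * g y)"
      unfolding cauchy_transform_def using integrable_cauchy_kernel[OF g] by simp
    also have "norm \<dots> \<le> (LINT y|lborel. sqrt (norm (z - w)) * (?k z y + ?k w y))"
    proof (rule Bochner_Integration.integral_norm_bound_integral)
      show "integrable lborel (\<lambda>y. sqrt (norm (z - w)) * (?k z y + ?k w y))"
        by (intro integrable_mult_right Bochner_Integration.integrable_add k_integrable)
      fix y
      have "norm (inverse (z - y) - inverse (w - y)) * norm (g y)
          \<le> sqrt (norm (z - w)) * (norm (z - y) powr - (3/2) + norm (w - y) powr - (3/2)) * norm (g y)"
        using norm_inverse_diff_le[of "z - y" "w - y"] by (intro mult_right_mono) auto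
      then show "norm (inverse (z - y) * g y - inverse (w - y) * g y)
          \<le> sqrt (norm (z - w)) * (?k z y + ?k w y)"
        by (simp add: norm_mult[symmetric] left_diff_distrib algebra_simps)
    qed (use integrable_cauchy_kernel[OF g] in simp)
    also have "\<dots> \<le> sqrt (norm (z - w)) * (K + K)"
      using k_integrable K[of z] K[of w] by (simp add: mult_left_mono)
    finally show ?thesis by (simp add: algebra_simps)
  qed
  then show ?thesis using that by blast
qed

lemma continuous_on_cauchy_transform:
  assumes "bdd_density g"
  shows "continuous_on S (cauchy_transform g)"
proof -
  obtain C where C: "\<And>z w. norm (cauchy_transform g z - cauchy_transform g w) \<le> C * sqrt (norm (z - w))"
    using cauchy_transform_hoelder[OF assms] by blast
  have "((\<lambda>z. C * sqrt (norm (z - w))) \<longlongrightarrow> 0) (at w)" for w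
    by (rule tendsto_eq_intros refl | simp)+
  then have "((\<lambda>z. cauchy_transform g z - cauchy_transform g w) \<longlongrightarrow> 0) (at w)" for w
    by (rule Lim_null_comparison[rotated]) (simp add: C)
  then have "isCont (cauchy_transform g) w" for w
    by (simp add: isCont_def LIM_zero_iff)
  then show ?thesis by (simp add: continuous_at_imp_continuous_on)
qed

lemma cauchy_transform_Fubini:
  assumes M: "sigma_finite_measure M" and \<phi>: "integrable M \<phi>" and \<gamma>: "\<gamma> \<in> borel_measurable M"
    and g: "bdd_density g"
  shows "integrable lborel (\<lambda>y. (LINT x|M. \<phi> x * inverse (\<gamma> x - y)) * g y)"
    and "(LINT x|M. \<phi> x * cauchy_transform g (\<gamma> x))
      = (LINT y|lborel. (LINT x|M. \<phi> x * inverse (\<gamma> x - y)) * g y)"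
proof -
  interpret pair_sigma_finite M "lborel :: complex measure"
    using M by (simp add: pair_sigma_finite_def lborel.sigma_finite_measure_axioms)
  have [measurable]: "\<phi> \<in> borel_measurable M" "\<gamma> \<in> borel_measurable M" "g \<in> borel_measurable borel"
    using \<phi> \<gamma> g by (auto simp: bdd_density_def)
  obtain K where K: "\<And>z. (LINT y|lborel. norm (inverse (z - y) * g y)) \<le> K"
    using integral_norm_cauchy_kernel_bounded[OF g] by blast
  define f where "f = (\<lambda>x y. \<phi> x * (inverse (\<gamma> x - y) * g y))"
  have f_measurable: "case_prod f \<in> borel_measurable (M \<Otimes>\<^sub>M lborel)"
    unfolding f_def by measurable
  have "integrable M (\<lambda>x. LINT y|lborel. norm (f x y))"
  proof (rule Bochner_Integration.integrable_bound)
    show "integrable M (\<lambda>x. norm (\<phi> x) * K)" using \<phi> by simp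
    have "norm (LINT y|lborel. norm (f x y)) \<le> norm (norm (\<phi> x) * K)" for x
    proof -
      have "(LINT y|lborel. norm (f x y)) = norm (\<phi> x) * (LINT y|lborel. norm (inverse (\<gamma> x - y) * g y))"
        unfolding f_def norm_mult[of "\<phi> x"] by (rule integral_mult_right_zero)
      also have "\<dots> \<le> norm (\<phi> x) * K" using K by (intro mult_left_mono) auto
      finally show ?thesis by simp
    qed
    then show "AE x in M. norm (LINT y|lborel. norm (f x y)) \<le> norm (norm (\<phi> x) * K)" by simp
  qed (use f_measurable in measurable)
  then have f_integrable: "integrable (M \<Otimes>\<^sub>M lborel) (case_prod f)"
    using integrable_cauchy_kernel[OF g]
    by (intro Fubini_integrable f_measurable AE_I2) (simp_all add: f_def)
  have inner: "(LINT x|M. f x y) = (LINT x|M. \<phi> x * inverse (\<gamma> x - y)) * g y" for y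
    by (simp add: f_def mult.assoc[symmetric])
  show "integrable lborel (\<lambda>y. (LINT x|M. \<phi> x * inverse (\<gamma> x - y)) * g y)"
    using integrable_snd[OF f_integrable] by (simp add: inner)
  show "(LINT x|M. \<phi> x * cauchy_transform g (\<gamma> x))
      = (LINT y|lborel. (LINT x|M. \<phi> x * inverse (\<gamma> x - y)) * g y)"
    using Fubini_integral[OF f_integrable] unfolding inner by (simp add: f_def cauchy_transform_def)
qed

lemma cauchy_transform_times_ident:
  assumes g: "bdd_density g"
  shows "cauchy_transform (\<lambda>y. y * g y) z = z * cauchy_transform g z - (LINT y|lborel. g y)"
proof -
  have "cauchy_transform (\<lambda>y. y * g y) z = (LINT y|lborel. z * (inverse (z - y) * g y) - g y)"
    unfolding cauchy_transform_def
  proof (rule integral_cong_AE)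
    show "AE y in lborel. inverse (z - y) * (y * g y) = z * (inverse (z - y) * g y) - g y"
      using AE_lborel_singleton[of z]
    proof eventually_elim
      case (elim y)
      then show ?case by (simp add: field_simps)
    qed
  qed (use g in measurable)
  also have "\<dots> = z * cauchy_transform g z - (LINT y|lborel. g y)"
    unfolding cauchy_transform_def using integrable_cauchy_kernel[OF g] integrable_bdd_density[OF g]
    by simp
  finally show ?thesis .
qed

text \<open>Symmetrization: the double integral of \<open>z / (z - y)\<close> is half of that of \<open>(z - y) / (z - y)\<close>.\<close>
lemma integral_times_cauchy_transform:
  assumes g: "bdd_density g"
  shows "2 * (LINT z|lborel. z * g z * cauchy_transform g z) = (LINT z|lborel. g z)\<^sup>2"
proof -
  note zg = bdd_density_times_ident[OF g]
  define m where "m = (LINT z|lborel. g z)"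
  define I where "I = (LINT z|lborel. z * g z * cauchy_transform g z)"
  have "(LINT z|lborel. z * g z * inverse (z - y)) = - cauchy_transform (\<lambda>z. z * g z) y" for y
    unfolding cauchy_transform_def Bochner_Integration.integral_minus[symmetric]
  proof (rule Bochner_Integration.integral_cong[OF refl])
    fix z
    have "inverse (z - y) = - inverse (y - z)" by (metis inverse_minus_eq minus_diff_eq)
    then show "z * g z * inverse (z - y) = - (inverse (y - z) * (z * g z))" by simp
  qed
  then have dual: "(LINT z|lborel. z * g z * inverse (z - y)) = m - y * cauchy_transform g y" for y
    by (simp add: m_def cauchy_transform_times_ident[OF g])
  note Fubini = cauchy_transform_Fubini[OF lborel.sigma_finite_measure_axioms
      integrable_bdd_density[OF zg] _ g, of "\<lambda>z. z", unfolded dual]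
  have mg: "integrable lborel (\<lambda>y. m * g y)"
    using integrable_bdd_density[OF g] by simp
  from Bochner_Integration.integrable_diff[OF mg Fubini(1)]
  have "integrable lborel (\<lambda>y. y * g y * cauchy_transform g y)"
    by (simp add: algebra_simps)
  moreover have "I = (LINT y|lborel. m * g y - y * g y * cauchy_transform g y)"
    unfolding I_def using Fubini(2) by (simp add: algebra_simps)
  ultimately have "I = m * m - I"
    using mg by (simp add: I_def m_def)
  then show ?thesis by (simp add: I_def m_def power2_eq_square)
qed

lemma cauchy_transform_tendsto_0_at_infinity:
  assumes g: "bdd_density g"
  shows "(cauchy_transform g \<longlongrightarrow> 0) at_infinity"
proof -
  obtain B M where support: "\<And>y. norm (g y) \<le> B * indicator (ball 0 M) y"
    using bdd_densityE[OF g] by metis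
  have "norm (cauchy_transform g z) \<le> inverse (norm z - M) * (LINT y|lborel. norm (g y))"
    if z: "norm z > M" for z
  proof -
    have "norm (cauchy_transform g z) \<le> (LINT y|lborel. inverse (norm z - M) * norm (g y))"
      unfolding cauchy_transform_def
    proof (rule Bochner_Integration.integral_norm_bound_integral[OF integrable_cauchy_kernel[OF g]])
      fix y
      show "norm (inverse (z - y) * g y) \<le> inverse (norm z - M) * norm (g y)"
      proof (cases "norm y < M")
        case True
        then have "norm z - M \<le> norm (z - y)" using norm_triangle_ineq2[of z y] by simp
        then have "inverse (norm (z - y)) \<le> inverse (norm z - M)"
          using z by (intro le_imp_inverse_le) auto
        then show ?thesis unfolding norm_mult norm_inverse by (rule mult_right_mono) auto
      qed (use support[of y] in auto)
    qed (use integrable_bdd_density[OF g] in simp)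
    then show ?thesis by simp
  qed
  then have "\<forall>\<^sub>F z in at_infinity. norm (cauchy_transform g z)
      \<le> inverse (norm z - M) * (LINT y|lborel. norm (g y))"
    unfolding eventually_at_infinity by (intro exI[of _ "M + 1"]) auto
  moreover have "filterlim (\<lambda>z::complex. - M + norm z) at_top at_infinity"
    by (intro filterlim_tendsto_add_at_top[OF tendsto_const] filterlim_norm_at_top)
  then have "((\<lambda>z::complex. inverse (norm z - M) * (LINT y|lborel. norm (g y))) \<longlongrightarrow> 0) at_infinity"
    by (intro tendsto_mult_left_zero tendsto_inverse_0_at_top) simp
  ultimately show ?thesis by (rule Lim_null_comparison)
qed

lemma times_cauchy_transform_at_infinity:
  assumes g: "bdd_density g"
  shows "((\<lambda>z. z * cauchy_transform g z) \<longlongrightarrow> (LINT y|lborel. g y)) at_infinity"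
  using cauchy_transform_tendsto_0_at_infinity[OF bdd_density_times_ident[OF g]]
  unfolding cauchy_transform_times_ident[OF g, abs_def] by (rule LIM_zero_cancel)

lemma cauchy_transform_add:
  assumes "bdd_density f" "bdd_density g"
  shows "cauchy_transform (\<lambda>y. f y + g y) z = cauchy_transform f z + cauchy_transform g z"
  unfolding cauchy_transform_def
  using integrable_cauchy_kernel[OF assms(1)] integrable_cauchy_kernel[OF assms(2)]
  by (simp add: distrib_left)

lemma cauchy_transform_translate:
  assumes "bdd_density g"
  shows "cauchy_transform (\<lambda>y. g (y - c)) z = cauchy_transform g (z - c)"
  unfolding cauchy_transform_def
  using integral_lborel_translate[of "\<lambda>y. inverse (z - c - y) * g y" c] assms by simp

lemma cauchy_transform_rotate:
  assumes g: "bdd_density g" and w: "norm w = 1"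
  shows "cauchy_transform (\<lambda>y. g (w * y)) z = w * cauchy_transform g (w * z)"
proof -
  have "orthogonal_transformation ((*) w)"
    by (simp add: orthogonal_transformation linear_times norm_mult w)
  then have "cauchy_transform g (w * z) = (LINT y|distr lborel borel ((*) w). inverse (w * z - y) * g y)"
    unfolding cauchy_transform_def by (subst lborel_distr_orthogonal) simp_all
  also have "\<dots> = (LINT y|lborel. inverse (w * z - w * y) * g (w * y))"
    using g by (subst integral_distr) auto
  also have "\<dots> = (LINT y|lborel. inverse w * (inverse (z - y) * g (w * y)))"
    by (simp add: right_diff_distrib[symmetric] mult.assoc)
  also have "\<dots> = inverse w * cauchy_transform (\<lambda>y. g (w * y)) z"
    unfolding cauchy_transform_def by (rule integral_mult_right_zero)
  finally show ?thesis using w by (auto simp: field_simps)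
qed

lemma cauchy_transform_difference_quotient:
  assumes g: "bdd_density g" and h: "bdd_density (\<lambda>y. inverse (z - y) * g y)"
  shows "cauchy_transform g w - cauchy_transform g z
    = - (w - z) * cauchy_transform (\<lambda>y. inverse (z - y) * g y) w"
proof -
  have "cauchy_transform g w - cauchy_transform g z
      = (LINT y|lborel. inverse (w - y) * g y - inverse (z - y) * g y)"
    unfolding cauchy_transform_def using integrable_cauchy_kernel[OF g] by simp
  also have "\<dots> = (LINT y|lborel. - (w - z) * (inverse (w - y) * (inverse (z - y) * g y)))"
  proof (rule integral_cong_AE)
    show "AE y in lborel. inverse (w - y) * g y - inverse (z - y) * g y
        = - (w - z) * (inverse (w - y) * (inverse (z - y) * g y))"
      using AE_lborel_singleton[of w] AE_lborel_singleton[of z]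
    proof eventually_elim
      case (elim y)
      then show ?case by (simp add: field_simps)
    qed
  qed (use g h in measurable)
  also have "\<dots> = - (w - z) * cauchy_transform (\<lambda>y. inverse (z - y) * g y) w"
    unfolding cauchy_transform_def by (rule integral_mult_right_zero)
  finally show ?thesis .
qed

lemma cauchy_transform_holomorphic:
  assumes g: "bdd_density g" and "open S" and vanish: "\<And>y. y \<in> S \<Longrightarrow> g y = 0"
  shows "cauchy_transform g holomorphic_on S"
  unfolding holomorphic_on_open[OF \<open>open S\<close>]
proof (intro ballI)
  fix z assume "z \<in> S"
  then obtain d where d: "d > 0" "ball z d \<subseteq> S" using \<open>open S\<close> openE by blast
  define h where "h = (\<lambda>y. inverse (z - y) * g y)"
  have h: "bdd_density h" unfolding h_def
  proof (rule bdd_density_mult[OF g, of _ "inverse d"])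
    fix y assume "g y \<noteq> 0"
    then have "y \<notin> ball z d" using d vanish by auto
    then show "norm (inverse (z - y)) \<le> inverse d"
      using d by (auto simp: norm_inverse dist_norm intro!: le_imp_inverse_le)
  qed measurable
  have "isCont (\<lambda>w. - cauchy_transform h w) z"
    using continuous_on_cauchy_transform[OF h, of UNIV]
    by (intro continuous_intros) (simp add: continuous_on_eq_continuous_at)
  moreover have "cauchy_transform g w - cauchy_transform g z = - cauchy_transform h w * (w - z)" for w
    using cauchy_transform_difference_quotient[OF g, of z w] h by (simp add: h_def algebra_simps)
  ultimately have "(cauchy_transform g has_field_derivative - cauchy_transform h z) (at z)"
    unfolding CARAT_DERIV by (intro exI[of _ "\<lambda>w. - cauchy_transform h w"]) auto
  then show "\<exists>f'. (cauchy_transform g has_field_derivative f') (at z)" ..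
qed

section \<open>Newton's shell theorem\<close>

lemma holomorphic_constant_on_circle_imp_constant:
  assumes f: "f holomorphic_on S" and S: "open S" "connected S"
    and circle: "sphere c r \<subseteq> S" "r > 0" "f constant_on sphere c r"
  shows "f constant_on S"
proof (rule analytic_continuation'[OF f S circle(1)])
  have ends: "c + of_real r \<in> sphere c r" "c - of_real r \<in> sphere c r"
    using circle(2) by (auto simp: dist_norm)
  then show "c + of_real r \<in> S" using circle(1) by blast
  have "c + of_real r \<noteq> c - of_real r" using circle(2) by (simp add: complex_eq_iff)
  then have "sphere c r \<noteq> {x}" for x using ends by (metis singletonD)
  then show "c + of_real r islimpt sphere c r"
    using ends(1) by (intro connected_imp_perfect connected_sphere) simp_all
qed (rule circle(3))

lemma times_cauchy_transform_constant_on_circle: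
  assumes g: "bdd_density g" and radial: "\<And>x y. norm x = norm y \<Longrightarrow> g x = g y"
  shows "(\<lambda>z. z * cauchy_transform g z) constant_on sphere 0 r"
proof (rule constant_on_subset[of _ "{z. norm z = r}"])
  have "z * cauchy_transform g z = of_real r * cauchy_transform g (of_real r)" if "norm z = r" for z
  proof (cases "r = 0")
    case False
    define w where "w = z / of_real r"
    have "norm w = 1" "z = w * of_real r" using that False by (auto simp: w_def norm_divide)
    moreover have "(\<lambda>y. g (w * y)) = g" using \<open>norm w = 1\<close> by (intro ext radial) (simp add: norm_mult)
    ultimately show ?thesis using cauchy_transform_rotate[OF g, of w "of_real r"] by simp
  qed (use that in auto)
  then show "(\<lambda>z. z * cauchy_transform g z) constant_on {z. norm z = r}"
    unfolding constant_on_def by auto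
qed auto

lemma cauchy_transform_radial_inside:
  assumes g: "bdd_density g" and radial: "\<And>x y. norm x = norm y \<Longrightarrow> g x = g y"
    and vanish: "\<And>y. norm y < r \<Longrightarrow> g y = 0" and z: "norm z \<le> r" "z \<noteq> 0"
  shows "cauchy_transform g z = 0"
proof -
  let ?G = "\<lambda>z. z * cauchy_transform g z"
  have "0 < norm z" using z by simp
  then have r: "r > 0" using z by linarith
  have "?G holomorphic_on ball 0 r"
    using vanish by (intro holomorphic_intros cauchy_transform_holomorphic g) auto
  then have "?G constant_on ball 0 r"
    by (rule holomorphic_constant_on_circle_imp_constant[where c = 0 and r = "r / 2"])
      (use r times_cauchy_transform_constant_on_circle[OF g radial] in auto)
  then have "?G u = ?G 0" if "u \<in> ball 0 r" for u
    using that r unfolding constant_on_def by (metis centre_in_ball)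
  moreover have "continuous_on (closure (ball 0 r)) ?G"
    by (intro continuous_intros continuous_on_cauchy_transform g)
  moreover have "z \<in> closure (ball 0 r)" using r z by simp
  ultimately have "?G z = 0"
    using continuous_constant_on_closure[of "ball 0 r" ?G 0 z] by simp
  then show ?thesis using z by simp
qed

lemma cauchy_transform_radial_outside:
  assumes g: "bdd_density g" and radial: "\<And>x y. norm x = norm y \<Longrightarrow> g x = g y"
    and vanish: "\<And>y. norm y > r \<Longrightarrow> g y = 0" and z: "norm z \<ge> r" and r: "r > 0"
  shows "z * cauchy_transform g z = (LINT y|lborel. g y)"
proof -
  let ?G = "\<lambda>z. z * cauchy_transform g z" and ?S = "- cball (0::complex) r"
  have "?G holomorphic_on ?S"
    using vanish by (intro holomorphic_intros cauchy_transform_holomorphic g) auto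
  then have "?G constant_on ?S"
  proof (rule holomorphic_constant_on_circle_imp_constant)
    show "connected ?S" by (intro connected_complement_bounded_convex) auto
    show "?G constant_on sphere 0 (r + 1)"
      by (rule times_cauchy_transform_constant_on_circle[OF g radial])
  qed (use r in auto)
  then obtain l where l: "\<And>u. u \<in> ?S \<Longrightarrow> ?G u = l" unfolding constant_on_def by auto
  then have "(?G \<longlongrightarrow> l) at_infinity"
    by (intro tendsto_eventually) (auto simp: eventually_at_infinity intro!: exI[of _ "r + 1"])
  then have "l = (LINT y|lborel. g y)"
    using times_cauchy_transform_at_infinity[OF g] tendsto_unique[OF trivial_limit_at_infinity] by blast
  moreover have "continuous_on (closure ?S) ?G"
    by (intro continuous_intros continuous_on_cauchy_transform g)
  then have "?G z = l"
    by (rule continuous_constant_on_closure[OF _ l]) (use z in \<open>auto simp: closure_complement\<close>)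
  ultimately show ?thesis by simp
qed

section \<open>The Cauchy transform of a domain\<close>

lemma integral_indicator_complex:
  fixes A :: "complex set"
  assumes "A \<in> sets borel" "bounded A"
  shows "(LINT y|lborel. indicator A y) = complex_of_real (measure lborel A)"
proof -
  have "(LINT y|lborel. indicator A y) = (LINT y|lborel. complex_of_real (indicator A y))"
    by (simp add: of_real_indicator)
  also have "\<dots> = complex_of_real (measure lborel A)"
    using assms by (simp only: integral_complex_of_real) simp
  finally show ?thesis .
qed

lemma cauchy_transform_centered_ball:
  assumes z: "norm z < r"
  shows "cauchy_transform (indicator (ball 0 r)) z = of_real pi * cnj z"
proof (cases "z = 0")
  case True
  have "bdd_density (indicator (ball 0 r) :: complex \<Rightarrow> complex)"
    by (intro bdd_density_indicator) auto
  moreover have "(\<lambda>y. indicator (ball 0 r) (- 1 * y)) = (indicator (ball 0 r) :: complex \<Rightarrow> complex)"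
    by (simp add: indicator_def fun_eq_iff)
  ultimately show ?thesis
    using cauchy_transform_rotate[of "indicator (ball 0 r)" "-1" 0] by (simp add: True)
next
  case False
  let ?inner = "indicator (cball 0 (norm z)) :: complex \<Rightarrow> complex"
  let ?outer = "indicator (ball 0 r - cball 0 (norm z)) :: complex \<Rightarrow> complex"
  have inner: "bdd_density ?inner" and outer: "bdd_density ?outer"
    by (auto intro!: bdd_density_indicator intro: bounded_subset[OF bounded_ball])
  have "z * cauchy_transform ?inner z = (LINT y|lborel. ?inner y)"
    using False
    by (intro cauchy_transform_radial_outside[OF inner, of "norm z"]) (auto simp: indicator_def)
  also have "\<dots> = z * (of_real pi * cnj z)"
    by (simp add: integral_indicator_complex content_cball unit_ball_vol_2 mult.left_commute
        flip: complex_norm_square)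
  finally have "cauchy_transform ?inner z = of_real pi * cnj z" using False by simp
  moreover have "cauchy_transform ?outer z = 0"
    using False
    by (intro cauchy_transform_radial_inside[OF outer, of "norm z"]) (auto simp: indicator_def)
  moreover have "indicator (ball 0 r) = (\<lambda>y. ?inner y + ?outer y)"
    using z by (auto simp: indicator_def fun_eq_iff)
  ultimately show ?thesis using cauchy_transform_add[OF inner outer, of z] by simp
qed

lemma cauchy_transform_ball:
  assumes z: "z \<in> ball c r"
  shows "cauchy_transform (indicator (ball c r)) z = of_real pi * cnj (z - c)"
proof -
  have "indicator (ball c r) = (\<lambda>y. indicator (ball 0 r) (y - c) :: complex)"
    by (auto simp: indicator_def fun_eq_iff dist_norm norm_minus_commute)
  then have "cauchy_transform (indicator (ball c r)) z = cauchy_transform (indicator (ball 0 r)) (z - c)"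
    using cauchy_transform_translate[OF bdd_density_indicator, of "ball 0 r" c z] by simp
  also have "\<dots> = of_real pi * cnj (z - c)"
    using z by (intro cauchy_transform_centered_ball) (simp add: dist_norm norm_minus_commute)
  finally show ?thesis .
qed

lemma cauchy_transform_open_minus_cnj_holomorphic:
  assumes D: "open D" "bounded D"
  shows "(\<lambda>z. cauchy_transform (indicator D) z - of_real pi * cnj z) holomorphic_on D"
proof -
  let ?H = "\<lambda>z. cauchy_transform (indicator D) z - of_real pi * cnj z"
  have "?H field_differentiable (at c)" if "c \<in> D" for c
  proof -
    obtain r where r: "r > 0" "ball c r \<subseteq> D" using D \<open>c \<in> D\<close> openE by blast
    let ?near = "indicator (ball c r) :: complex \<Rightarrow> complex"
    let ?far = "indicator (D - ball c r) :: complex \<Rightarrow> complex"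
    have near: "bdd_density ?near" and far: "bdd_density ?far"
      using D by (auto intro!: bdd_density_indicator intro: bounded_subset)
    have "indicator D = (\<lambda>y. ?near y + ?far y)"
      using r by (auto simp: indicator_def fun_eq_iff)
    then have split: "cauchy_transform (indicator D) z
        = cauchy_transform ?near z + cauchy_transform ?far z" for z
      using cauchy_transform_add[OF near far] by simp
    have "(\<lambda>z. cauchy_transform ?far z - of_real pi * cnj c) holomorphic_on ball c r"
      by (intro holomorphic_intros cauchy_transform_holomorphic far) auto
    then have "?H holomorphic_on ball c r"
      by (rule holomorphic_transform) (simp add: split cauchy_transform_ball algebra_simps)
    then show ?thesis using r by (auto intro: holomorphic_on_imp_differentiable_at)
  qed
  then show ?thesis by (simp add: holomorphic_on_def field_differentiable_at_within)
qed

section \<open>The logarithmic potential\<close>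

definition log_potential :: "(complex \<Rightarrow> real) \<Rightarrow> complex \<Rightarrow> real" where
  "log_potential g z = (LINT y|lborel. ln (norm (z - y)) * g y)"

lemma abs_ln_le_inverse_plus_self:
  fixes t :: real
  assumes "t > 0"
  shows "\<bar>ln t\<bar> \<le> inverse t + t"
proof -
  have "ln t \<le> t" "- ln t \<le> inverse t"
    using ln_le_minus_one[of t] ln_le_minus_one[of "inverse t"] assms by (simp_all add: ln_inverse)
  moreover have "inverse t > 0" using assms by simp
  ultimately show ?thesis using assms unfolding abs_le_iff by linarith
qed

lemma integrable_log_kernel:
  fixes g :: "complex \<Rightarrow> real"
  assumes g: "bdd_density g"
  shows "integrable lborel (\<lambda>y. ln (norm (z - y)) * g y)"
proof -
  obtain B M where "M > 0" and support: "\<And>y. norm (g y) \<le> B * indicator (ball 0 M) y"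
    using bdd_densityE[OF g] by metis
  let ?h = "\<lambda>y. norm (inverse (z - y) * of_real (g y)) + (norm z + M) * \<bar>g y\<bar>"
  show ?thesis
  proof (rule Bochner_Integration.integrable_bound)
    show "integrable lborel ?h"
      using integrable_cauchy_kernel[OF bdd_density_of_real[OF g]] integrable_bdd_density[OF g] by simp
    have "norm (ln (norm (z - y)) * g y) \<le> ?h y" for y
    proof (cases "z = y \<or> g y = 0")
      case False
      then have "norm y < M" using support[of y] by (cases "norm y < M") auto
      then have "norm (z - y) \<le> norm z + M" using norm_triangle_ineq4[of z y] by linarith
      then have "\<bar>ln (norm (z - y))\<bar> \<le> inverse (norm (z - y)) + (norm z + M)"
        using abs_ln_le_inverse_plus_self[of "norm (z - y)"] False by simp
      then have "\<bar>ln (norm (z - y))\<bar> * \<bar>g y\<bar> \<le> (inverse (norm (z - y)) + (norm z + M)) * \<bar>g y\<bar>"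
        by (rule mult_right_mono) simp
      then show ?thesis by (simp add: norm_mult norm_inverse abs_mult distrib_right)
    qed (use \<open>M > 0\<close> in auto)
    then show "AE y in lborel. norm (ln (norm (z - y)) * g y) \<le> norm (?h y)"
      using abs_ge_self order_trans unfolding real_norm_def[of "?h _"] by (intro AE_I2) blast
  qed (use g in measurable)
qed

lemma has_derivative_ln_norm:
  fixes z :: complex
  assumes "z \<noteq> 0"
  shows "((\<lambda>z. ln (norm z)) has_derivative (\<lambda>v. Re (v / z))) (at z)"
proof -
  have "((\<lambda>z. ln (norm z)) has_derivative (\<lambda>v. (v \<bullet> sgn z) * inverse (norm z))) (at z)"
    using assms by (auto intro!: derivative_eq_intros has_derivative_norm simp: divide_inverse)
  moreover have "(v \<bullet> sgn z) * inverse (norm z) = Re (v / z)" for v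
  proof -
    have "(v \<bullet> sgn z) * inverse (norm z) = (v \<bullet> z) / (norm z)\<^sup>2"
      by (simp add: sgn_div_norm divide_inverse power2_eq_square)
    then show ?thesis by (simp add: Re_divide inner_complex_def cmod_power2)
  qed
  ultimately show ?thesis by simp
qed

lemma contour_integral_linepath_eq_lborel:
  assumes "continuous_on (closed_segment a b) f"
  shows "contour_integral (linepath a b) f
    = (LINT t|lborel. indicator {0..1} t *\<^sub>R (b - a) * f (linepath a b t))"
proof -
  have cont: "continuous_on {0..1} (\<lambda>t. f (linepath a b t) * (b - a))"
    using assms
    by (intro continuous_intros continuous_on_compose2[OF assms]) (auto simp: linepath_in_path)
  note set_integral = set_borel_integral_eq_integral[OF borel_integrable_atLeastAtMost'[OF cont]]
  have "((\<lambda>t. f (linepath a b t) * (b - a)) has_integral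
      (LINT t:{0..1}|lborel. f (linepath a b t) * (b - a))) {0..1}"
    unfolding set_integral(2) by (rule integrable_integral[OF set_integral(1)])
  then have "contour_integral (linepath a b) f = (LINT t:{0..1}|lborel. f (linepath a b t) * (b - a))"
    by (intro contour_integral_unique) (simp add: has_contour_integral_linepath)
  also have "\<dots> = (LINT t|lborel. indicator {0..1} t *\<^sub>R (b - a) * f (linepath a b t))"
    unfolding set_lebesgue_integral_def by (intro Bochner_Integration.integral_cong) auto
  finally show ?thesis .
qed

lemma Re_contour_integral_inverse_linepath:
  assumes "y \<notin> closed_segment a b"
  shows "Re (contour_integral (linepath a b) (\<lambda>u. inverse (u - y)))
    = ln (norm (b - y)) - ln (norm (a - y))"
proof -
  let ?I = "contour_integral (linepath a b) (\<lambda>u. inverse (u - y))"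
  have nonzero: "linepath a b t - y \<noteq> 0" if "t \<in> {0..1}" for t
    using assms linepath_in_path[OF that, of a b] by auto
  have cont: "continuous_on (closed_segment a b) (\<lambda>u. inverse (u - y))"
    using assms by (intro continuous_intros) auto
  have "((\<lambda>t. inverse (linepath a b t - y) * (b - a)) has_integral ?I) {0..1}"
    using has_contour_integral_integral[OF contour_integrable_continuous_linepath[OF cont]]
    by (simp only: has_contour_integral_linepath)
  from has_integral_Re[OF this]
  have "((\<lambda>t. Re ((b - a) / (linepath a b t - y))) has_integral Re ?I) {0..1}"
    by (simp only: divide_inverse mult.commute)
  moreover have "((\<lambda>t. Re ((b - a) / (linepath a b t - y))) has_integral
      ln (norm (linepath a b 1 - y)) - ln (norm (linepath a b 0 - y))) {0..1}"
  proof (rule fundamental_theorem_of_calculus)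
    fix t :: real assume t: "t \<in> {0..1}"
    have "((\<lambda>t. linepath a b t - y) has_vector_derivative (b - a)) (at t within {0..1})"
      by (auto intro!: derivative_eq_intros has_vector_derivative_linepath_within)
    from vector_derivative_diff_chain_within[OF this
        has_derivative_at_withinI[OF has_derivative_ln_norm[OF nonzero[OF t]]]]
    show "((\<lambda>t. ln (norm (linepath a b t - y))) has_vector_derivative
        Re ((b - a) / (linepath a b t - y))) (at t within {0..1})"
      by (simp add: o_def)
  qed simp
  ultimately show ?thesis using has_integral_unique by (simp add: linepath_def)
qed

lemma AE_lborel_not_in_closed_segment:
  fixes a b :: "'a::euclidean_space"
  assumes "2 \<le> DIM('a)"
  shows "AE y in lborel. y \<notin> closed_segment a b"
proof -
  have "negligible (closed_segment a b)"
    using assms by (simp add: negligible_convex_interior interior_closed_segment_ge2)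
  then have "closed_segment a b \<in> null_sets lborel"
    by (simp add: negligible_iff_null_sets null_sets_completion_iff borel_closed)
  then show ?thesis by (rule AE_not_in)
qed

lemma log_potential_increment:
  assumes g: "bdd_density g"
  shows "log_potential g w - log_potential g z
    = Re (contour_integral (linepath z w) (cauchy_transform (\<lambda>y. of_real (g y))))"
proof -
  note cg = bdd_density_of_real[OF g, where 'b = complex]
  let ?F = "cauchy_transform (\<lambda>y. of_real (g y))"
  define \<phi> where "\<phi> = (\<lambda>t::real. indicator {0..1} t *\<^sub>R (w - z))"
  define k where "k = (\<lambda>y. LINT t|lborel. \<phi> t * inverse (linepath z w t - y))"
  have \<phi>: "integrable lborel \<phi>"
    unfolding \<phi>_def by (intro integrable_scaleR_left integrable_real_indicator) auto
  have line: "linepath z w \<in> borel_measurable lborel"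
    using continuous_on_linepath[of UNIV z w] by (simp add: borel_measurable_continuous_onI)
  note Fubini = cauchy_transform_Fubini[OF lborel.sigma_finite_measure_axioms \<phi> line cg]
  have "contour_integral (linepath z w) ?F = (LINT t|lborel. \<phi> t * ?F (linepath z w t))"
    unfolding \<phi>_def by (intro contour_integral_linepath_eq_lborel continuous_on_cauchy_transform cg)
  also have "\<dots> = (LINT y|lborel. k y * of_real (g y))"
    unfolding k_def by (rule Fubini(2))
  finally have "Re (contour_integral (linepath z w) ?F) = (LINT y|lborel. Re (k y * of_real (g y)))"
    by (simp only: integral_Re[OF Fubini(1)] k_def)
  also have "\<dots> = (LINT y|lborel. ln (norm (w - y)) * g y - ln (norm (z - y)) * g y)"
  proof (rule integral_cong_AE)
    have "AE y in lborel. y \<notin> closed_segment z w" by (rule AE_lborel_not_in_closed_segment) simp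
    then show "AE y in lborel. Re (k y * of_real (g y)) = ln (norm (w - y)) * g y - ln (norm (z - y)) * g y"
    proof eventually_elim
      case (elim y)
      then have "k y = contour_integral (linepath z w) (\<lambda>u. inverse (u - y))"
        unfolding k_def \<phi>_def
        by (intro contour_integral_linepath_eq_lborel[symmetric] continuous_intros) auto
      then show ?case
        using Re_contour_integral_inverse_linepath[OF elim] by (simp add: left_diff_distrib)
    qed
    show "(\<lambda>y. Re (k y * of_real (g y))) \<in> borel_measurable lborel"
      using borel_measurable_integrable[OF Fubini(1)] unfolding k_def by measurable
  qed (use g in measurable)
  also have "\<dots> = log_potential g w - log_potential g z"
    unfolding log_potential_def by (intro Bochner_Integration.integral_diff integrable_log_kernel g)
  finally show ?thesis by simp
qed

lemma has_derivative_log_potential: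
  assumes g: "bdd_density g"
  shows "(log_potential g has_derivative (\<lambda>v. Re (v * cauchy_transform (\<lambda>y. of_real (g y)) z))) (at z)"
  unfolding has_derivative_at_alt
proof (intro conjI allI impI)
  let ?F = "cauchy_transform (\<lambda>y. of_real (g y))" and ?U = "log_potential g"
  have cont: "continuous_on S ?F" for S
    by (intro continuous_on_cauchy_transform bdd_density_of_real g)
  show "bounded_linear (\<lambda>v. Re (v * ?F z))"
    by (intro bounded_linear_compose[OF bounded_linear_Re] bounded_linear_mult_left)
  fix e :: real assume "e > 0"
  then obtain d where d: "d > 0" "\<And>u. dist u z < d \<Longrightarrow> dist (?F u) (?F z) < e"
    using cont[of UNIV] unfolding continuous_on_eq_continuous_at[OF open_UNIV] continuous_at_eps_delta
    by blast
  have "norm (?U y - ?U z - Re ((y - z) * ?F z)) \<le> e * norm (y - z)" if y: "norm (y - z) < d" for y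
  proof -
    have integrable: "?F contour_integrable_on linepath z y"
      by (intro contour_integrable_continuous_linepath cont)
    have "?U y - ?U z - Re ((y - z) * ?F z) = Re (contour_integral (linepath z y) (\<lambda>u. ?F u - ?F z))"
      using integrable by (simp add: log_potential_increment[OF g] contour_integral_diff mult.commute)
    also have "norm \<dots> \<le> norm (contour_integral (linepath z y) (\<lambda>u. ?F u - ?F z))"
      by (simp add: abs_Re_le_cmod)
    also have "\<dots> \<le> e * norm (y - z)"
    proof (rule contour_integral_bound_linepath)
      show "(\<lambda>u. ?F u - ?F z) contour_integrable_on linepath z y"
        using integrable by (intro contour_integrable_diff) auto
      fix u assume "u \<in> closed_segment z y"
      then have "dist u z < d" using y segment_bound(1)[of u z y] by (simp add: dist_norm)
      then show "norm (?F u - ?F z) \<le> e" using d(2)[of u] by (simp add: dist_norm)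
    qed (use \<open>e > 0\<close> in simp)
    finally show ?thesis .
  qed
  then show "\<exists>d>0. \<forall>y. norm (y - z) < d \<longrightarrow> norm (?U y - ?U z - Re ((y - z) * ?F z)) \<le> e * norm (y - z)"
    using d(1) by blast
qed

lemma stream_fun_eq_log_potential:
  assumes A: "A \<in> sets borel" "bounded A"
  shows "stream_fun A x = log_potential (indicator A) x / (2 * pi)"
proof -
  have "set_integrable lborel A (\<lambda>y. ln (norm (x - y)))"
    using integrable_log_kernel[OF bdd_density_indicator[OF A], of x]
    by (simp add: set_integrable_def mult.commute)
  then have "integral A (\<lambda>y. ln (norm (x - y))) = (LINT y:A|lborel. ln (norm (x - y)))"
    by (rule set_borel_integral_eq_integral(2)[symmetric])
  also have "\<dots> = log_potential (indicator A) x"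
    by (simp add: set_lebesgue_integral_def log_potential_def mult.commute)
  finally show ?thesis by (simp add: stream_fun_def)
qed

section \<open>Harmonic functions and measure comparison\<close>

lemma holomorphic_Re_max_imp_constant:
  assumes f: "f holomorphic_on S" and S: "open S" "connected S"
    and max: "\<xi> \<in> S" "\<And>z. z \<in> S \<Longrightarrow> Re (f z) \<le> Re (f \<xi>)"
  shows "f constant_on S"
proof (rule ccontr)
  assume "\<not> f constant_on S"
  then have "open (f ` S)" using f S by (intro open_mapping_thm[of f S S]) auto
  then obtain e where e: "e > 0" "cball (f \<xi>) e \<subseteq> f ` S"
    using max(1) open_contains_cball by blast
  then have "f \<xi> + of_real e \<in> f ` S" by (auto simp: dist_norm)
  then obtain z where "z \<in> S" "f z = f \<xi> + of_real e" by auto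
  then show False using max(2)[of z] e(1) by simp
qed

text \<open>A real function \<open>h\<close> with derivative \<open>\<lambda>v. Re (v * H z)\<close>, i.e. gradient \<open>cnj (H z)\<close>, is harmonic
  when \<open>H\<close> is holomorphic.\<close>
lemma harmonic_max_imp_gradient_zero:
  assumes H: "H holomorphic_on S" and S: "open S" "connected S"
    and h: "\<And>z. z \<in> S \<Longrightarrow> (h has_derivative (\<lambda>v. Re (v * H z))) (at z)"
    and max: "\<xi> \<in> S" "\<And>z. z \<in> S \<Longrightarrow> h z \<le> h \<xi>" and z: "z \<in> S"
  shows "H z = 0"
proof -
  obtain r where r: "r > 0" "ball \<xi> r \<subseteq> S" using S(1) max(1) openE by blast
  let ?B = "ball \<xi> r"
  obtain P where "\<And>u. u \<in> ?B \<Longrightarrow> (P has_field_derivative H u) (at u within ?B)"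
    using holomorphic_convex_primitive'[OF convex_ball open_ball holomorphic_on_subset[OF H r(2)]]
    by blast
  then have P: "(P has_field_derivative H u) (at u)" if "u \<in> ?B" for u
    using that at_within_open[OF that open_ball] by metis
  have "((\<lambda>u. h u - Re (P u)) has_derivative (\<lambda>v. 0)) (at u within ?B)" if "u \<in> ?B" for u
  proof -
    have "((\<lambda>u. Re (P u)) has_derivative (\<lambda>v. Re (H u * v))) (at u)"
      using P[OF that]
      by (intro bounded_linear.has_derivative[OF bounded_linear_Re]) (simp add: has_field_derivative_def)
    moreover have "u \<in> S" using that r(2) by blast
    ultimately have "((\<lambda>u. h u - Re (P u)) has_derivative (\<lambda>v. Re (v * H u) - Re (H u * v))) (at u)"
      by (intro has_derivative_diff h)
    then show ?thesis by (simp add: mult.commute has_derivative_at_withinI)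
  qed
  from has_derivative_zero_constant[OF convex_ball this]
  obtain c where c: "\<And>u. u \<in> ?B \<Longrightarrow> h u - Re (P u) = c" by auto
  have "Re (P u) \<le> Re (P \<xi>)" if "u \<in> ?B" for u
    using c[OF that] c[of \<xi>] max(2)[of u] that r by auto
  moreover have "P holomorphic_on ?B"
    using P holomorphic_on_open by blast
  ultimately have "P constant_on ?B"
    using r(1) by (intro holomorphic_Re_max_imp_constant[of P ?B \<xi>]) auto
  then obtain k where k: "\<And>u. u \<in> ?B \<Longrightarrow> P u = k" unfolding constant_on_def by blast
  have "H u = 0" if "u \<in> ?B" for u
  proof (rule DERIV_unique[OF P[OF that]])
    show "(P has_field_derivative 0) (at u)"
      by (rule has_field_derivative_transform_within_open[of "\<lambda>_. k" _ _ ?B]) (use that k in auto)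
  qed
  then show ?thesis
    using analytic_continuation_open[of ?B S H "\<lambda>_. 0"] r S H z by auto
qed

lemma harmonic_constant_on_frontier_imp_gradient_zero:
  assumes H: "H holomorphic_on S" and S: "open S" "connected S" "bounded S"
    and h: "\<And>z. z \<in> S \<Longrightarrow> (h has_derivative (\<lambda>v. Re (v * H z))) (at z)"
    and cont: "continuous_on (closure S) h" and frontier: "\<And>x. x \<in> frontier S \<Longrightarrow> h x = c" and z: "z \<in> S"
  shows "H z = 0"
proof -
  have compact: "compact (closure S)" "closure S \<noteq> {}" and sub: "S \<subseteq> closure S"
    using S z closure_subset by auto
  obtain a where a: "a \<in> closure S" "\<And>y. y \<in> closure S \<Longrightarrow> h y \<le> h a"
    using continuous_attains_sup[OF compact cont] by blast
  obtain b where b: "b \<in> closure S" "\<And>y. y \<in> closure S \<Longrightarrow> h b \<le> h y"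
    using continuous_attains_inf[OF compact cont] by blast
  have "frontier S = closure S - S" using S(1) by (simp add: frontier_def interior_open)
  then consider "a \<in> S" | "b \<in> S" | "a \<in> frontier S" "b \<in> frontier S" using a(1) b(1) by blast
  then show ?thesis
  proof cases
    case 1
    then show ?thesis
      using a(2) sub z by (intro harmonic_max_imp_gradient_zero[OF H S(1,2) h, of a]) auto
  next
    case 2
    have "((\<lambda>u. - h u) has_derivative (\<lambda>v. Re (v * - H u))) (at u)" if "u \<in> S" for u
      using has_derivative_minus[OF h[OF that]] by simp
    then have "- H z = 0"
      using 2 b(2) sub z H
      by (intro harmonic_max_imp_gradient_zero[of "\<lambda>u. - H u" S "\<lambda>u. - h u" b])
        (auto intro: holomorphic_intros S)
    then show ?thesis by simp
  next
    case 3
    then have "h y = c" if "y \<in> S" for y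
      using a(2)[of y] b(2)[of y] frontier that sub by force
    then show ?thesis
      using z by (intro harmonic_max_imp_gradient_zero[OF H S(1,2) h, of z]) auto
  qed
qed

lemma null_sets_diff_of_measure_eq:
  assumes "A \<in> fmeasurable M" "B \<in> fmeasurable M" "measure M A = measure M B"
    and null: "B - A \<in> null_sets M"
  shows "A - B \<in> null_sets M"
proof -
  have integrable: "integrable M (\<lambda>x. indicator A x - indicator B x :: real)"
    using assms by (auto simp: fmeasurable_def)
  have "AE x in M. 0 \<le> indicator A x - (indicator B x :: real)"
    using AE_not_in[OF null] by eventually_elim (auto simp: indicator_def)
  moreover have "(LINT x|M. indicator A x - indicator B x) = (0::real)"
    using assms by (auto simp: fmeasurable_def)
  ultimately have "AE x in M. indicator A x - indicator B x = (0::real)"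
    using integral_nonneg_eq_0_iff_AE[OF integrable] by simp
  then have "AE x in M. x \<notin> A - B"
    by eventually_elim (auto simp: indicator_def)
  then show ?thesis
    using assms by (subst AE_iff_null_sets) auto
qed

lemma bathtub_minimizer_unique:
  fixes f :: "'a \<Rightarrow> real"
  assumes fmeasurable: "A \<in> fmeasurable M" "B \<in> fmeasurable M" "measure M A = measure M B"
    and integrable: "set_integrable M A f" "set_integrable M B f"
    and minimal: "(LINT x:A|M. f x) \<le> (LINT x:B|M. f x)"
    and sublevel: "\<And>x. x \<in> B \<longleftrightarrow> f x < c"
  shows "A - B \<in> null_sets M" "B - A \<in> null_sets M"
proof -
  define d where "d = (\<lambda>x. (indicator A x - indicator B x) * (f x - c))"
  have d_eq: "d = (\<lambda>x. (indicator A x *\<^sub>R f x - c * indicator A x)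
      - (indicator B x *\<^sub>R f x - c * indicator B x))"
    by (auto simp: d_def algebra_simps)
  have d_nonneg: "d x \<ge> 0" for x
    using sublevel[of x] by (auto simp: d_def indicator_def)
  have indicators: "integrable M (indicator A :: 'a \<Rightarrow> real)" "integrable M (indicator B :: 'a \<Rightarrow> real)"
    using fmeasurable by (auto simp: fmeasurable_def)
  have d_integrable: "integrable M d"
    unfolding d_eq using integrable indicators by (auto simp: set_integrable_def)
  have "integral\<^sup>L M d = (LINT x:A|M. f x) - (LINT x:B|M. f x)"
    unfolding d_eq using integrable indicators fmeasurable
    by (simp add: set_integrable_def set_lebesgue_integral_def)
  then have "integral\<^sup>L M d = 0"
    using minimal Bochner_Integration.integral_nonneg[of M d] d_nonneg by (simp add: order_antisym)
  then have "AE x in M. d x = 0"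
    using integral_nonneg_eq_0_iff_AE[OF d_integrable] d_nonneg by simp
  then have "AE x in M. x \<notin> B - A"
  proof eventually_elim
    case (elim x)
    then show ?case using sublevel[of x] by (auto simp: d_def indicator_def split: if_splits)
  qed
  then show "B - A \<in> null_sets M"
    using fmeasurable by (subst AE_iff_null_sets) auto
  then show "A - B \<in> null_sets M"
    by (rule null_sets_diff_of_measure_eq[OF fmeasurable])
qed

lemma open_subset_of_negligible_diff:
  fixes U V :: "'a::euclidean_space set"
  assumes "open V" and null: "negligible (V - U)" and frontier: "frontier U \<subseteq> closure (- closure U)"
  shows "V \<subseteq> U"
proof -
  have "negligible (V - closure U)"
    using null closure_subset[of U] by (auto intro: negligible_subset)
  then have disjoint: "V \<inter> - closure U = {}"
    using open_not_negligible[of "V - closure U"] \<open>open V\<close> by auto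
  then have "V \<inter> closure (- closure U) = {}"
    using \<open>open V\<close> open_Int_closure_eq_empty by blast
  then show ?thesis
    using frontier disjoint by (auto simp: frontier_def dest: interior_subset[THEN subsetD])
qed

lemma frontier_ball_subset_closure_exterior:
  fixes c :: "'a::euclidean_space"
  assumes "r > 0"
  shows "frontier (ball c r) \<subseteq> closure (- closure (ball c r))"
  using assms by (auto simp: closure_complement frontier_ball)

lemma C1_boundary_frontier_subset_closure_exterior:
  assumes "C1_boundary D"
  shows "frontier D \<subseteq> closure (- closure D)"
proof
  fix p assume p: "p \<in> frontier D"
  obtain r \<theta> f where r: "r > 0" and f: "f C1_differentiable_on UNIV" "f 0 = 0"
    and graph: "D \<inter> ball p r = {x \<in> ball p r. Im (cis \<theta> * (x - p)) < f (Re (cis \<theta> * (x - p)))}"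
    using assms p unfolding C1_boundary_def by blast
  define W where "W = {x. f (Re (cis \<theta> * (x - p))) < Im (cis \<theta> * (x - p))} \<inter> ball p r"
  have "open W" unfolding W_def
    by (intro open_Int open_ball open_Collect_less continuous_intros
        continuous_on_compose2[OF C1_differentiable_imp_continuous_on[OF f(1)]]) auto
  moreover have "W \<inter> D = {}" using graph by (force simp: W_def)
  ultimately have exterior: "W \<subseteq> - closure D" using open_Int_closure_eq_empty by blast
  show "p \<in> closure (- closure D)"
    unfolding closure_approachable
  proof (intro allI impI)
    fix e :: real assume "e > 0"
    define s where "s = min r e / 2"
    have s: "0 < s" "s < r" "s < e" using r \<open>e > 0\<close> by (auto simp: s_def)
    define q where "q = p + cis (- \<theta>) * (\<i> * of_real s)"
    have "cis \<theta> * (q - p) = \<i> * of_real s"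
      by (simp add: q_def mult.assoc[symmetric] cis_mult)
    then have "f (Re (cis \<theta> * (q - p))) < Im (cis \<theta> * (q - p))"
      using s f(2) by (simp only:) simp
    moreover have "dist q p = s" using s by (simp add: q_def dist_norm norm_mult)
    ultimately have "q \<in> W" using s by (simp add: W_def dist_commute)
    then show "\<exists>y\<in>- closure D. dist y p < e" using exterior s \<open>dist q p = s\<close> by auto
  qed
qed

section \<open>Rotating patches with angular velocity one half\<close>

lemma cauchy_transform_eq_cnj_of_boundary_condition:
  assumes D: "open D" "connected D" "bounded D"
    and bc: "\<And>x. x \<in> frontier D \<Longrightarrow> stream_fun D x - (1/4) * (norm x)\<^sup>2 = \<mu>"
    and z: "z \<in> D"
  shows "cauchy_transform (indicator D) z = of_real pi * cnj z"
proof -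
  have borel: "D \<in> sets borel" using D by simp
  note g = bdd_density_indicator[OF borel D(3), where 'b = real]
  let ?H = "\<lambda>x. cauchy_transform (indicator D) x - of_real pi * cnj x"
  define h where "h = (\<lambda>x. log_potential (indicator D) x - pi / 2 * (norm x)\<^sup>2)"
  have deriv: "(h has_derivative (\<lambda>v. Re (v * ?H x))) (at x)" for x
  proof -
    have "((\<lambda>x::complex. (norm x)\<^sup>2) has_derivative (\<lambda>v. 2 * Re (v * cnj x))) (at x)"
      unfolding power2_norm_eq_inner
      by (auto intro!: derivative_eq_intros simp: inner_complex_def algebra_simps)
    then have "(h has_derivative
        (\<lambda>v. Re (v * cauchy_transform (indicator D) x) - pi / 2 * (2 * Re (v * cnj x)))) (at x)"
      unfolding h_def using has_derivative_log_potential[OF g]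
      by (intro has_derivative_diff has_derivative_mult_right) (simp_all add: of_real_indicator)
    then show ?thesis by (simp add: algebra_simps)
  qed
  have "?H z = 0"
  proof (rule harmonic_constant_on_frontier_imp_gradient_zero[OF _ D deriv])
    show "?H holomorphic_on D" by (rule cauchy_transform_open_minus_cnj_holomorphic[OF D(1,3)])
    show "continuous_on (closure D) h"
      by (intro continuous_at_imp_continuous_on ballI has_derivative_continuous[OF deriv])
    show "h x = 2 * pi * \<mu>" if "x \<in> frontier D" for x
      using bc[OF that] by (simp add: h_def stream_fun_eq_log_potential[OF borel D(3)] field_simps)
  qed (rule z)
  then show ?thesis by simp
qed

lemma second_moment_of_cauchy_transform_eq:
  assumes D: "D \<in> sets borel" "bounded D"
    and F: "\<And>z. z \<in> D \<Longrightarrow> cauchy_transform (indicator D) z = of_real pi * cnj z"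
  shows "(LINT z:D|lborel. (norm z)\<^sup>2) = (measure lborel D)\<^sup>2 / (2 * pi)"
proof -
  have "z * indicator D z * cauchy_transform (indicator D) z
      = of_real (pi * (indicator D z *\<^sub>R (norm z)\<^sup>2))" for z
    by (cases "z \<in> D") (simp_all add: F flip: complex_norm_square)
  then have "(LINT z|lborel. z * indicator D z * cauchy_transform (indicator D) z)
      = of_real (pi * (LINT z:D|lborel. (norm z)\<^sup>2))"
    by (simp only: integral_complex_of_real set_lebesgue_integral_def integral_mult_right_zero)
  then have "of_real (2 * (pi * (LINT z:D|lborel. (norm z)\<^sup>2))) = complex_of_real ((measure lborel D)\<^sup>2)"
    using integral_times_cauchy_transform[OF bdd_density_indicator[OF D]] integral_indicator_complex[OF D]
    by simp
  then have "2 * (pi * (LINT z:D|lborel. (norm z)\<^sup>2)) = (measure lborel D)\<^sup>2"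
    by (simp only: of_real_eq_iff)
  then show ?thesis by (simp add: field_simps)
qed

lemma set_integrable_norm_power:
  fixes A :: "'a::euclidean_space set"
  assumes "A \<in> sets borel" "bounded A"
  shows "set_integrable lborel A (\<lambda>z. norm z ^ n)"
proof -
  obtain b where "\<And>z. z \<in> A \<Longrightarrow> norm z \<le> b" using \<open>bounded A\<close> unfolding bounded_iff by blast
  then have "bdd_density (\<lambda>z. norm z ^ n * indicator A z)"
    using assms by (intro bdd_density_mult[OF bdd_density_indicator, of _ _ "b ^ n"])
      (auto simp: power_mono indicator_eq_0_iff)
  then show ?thesis
    using integrable_bdd_density by (simp add: set_integrable_def mult.commute)
qed

lemma negligible_diff_ball_of_cauchy_transform_eq:
  assumes D: "open D" "D \<noteq> {}" "bounded D"
    and F: "\<And>z. z \<in> D \<Longrightarrow> cauchy_transform (indicator D) z = of_real pi * cnj z"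
  obtains r where "r > 0" "negligible (D - ball 0 r)" "negligible (ball 0 r - D)"
proof -
  let ?m = "measure lborel D"
  have fmeasurable: "A \<in> fmeasurable lborel" if "open A" "bounded A" for A :: "complex set"
    using that by (intro fmeasurableI emeasure_bounded_finite) auto
  have "?m \<noteq> 0"
    using open_not_negligible[OF D(1,2)] D fmeasurable[of D]
    by (simp add: negligible_iff_null_sets null_sets_completion_iff null_sets_def emeasure_eq_measure2)
  then have "?m > 0" by (simp add: less_le)
  define r where "r = sqrt (?m / pi)"
  let ?B = "ball (0::complex) r"
  have "r > 0" using \<open>?m > 0\<close> by (simp add: r_def)
  have measure_B: "?m = measure lborel ?B"
    using \<open>?m > 0\<close> \<open>r > 0\<close> by (simp add: content_ball unit_ball_vol_2) (simp add: r_def)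
  have "(LINT z:D|lborel. (norm z)\<^sup>2) = ?m\<^sup>2 / (2 * pi)"
    using D F by (intro second_moment_of_cauchy_transform_eq) auto
  also have "\<dots> = (LINT z:?B|lborel. (norm z)\<^sup>2)"
    unfolding measure_B using cauchy_transform_ball[of _ 0 r]
    by (intro second_moment_of_cauchy_transform_eq[symmetric]) auto
  finally have minimal: "(LINT z:D|lborel. (norm z)\<^sup>2) \<le> (LINT z:?B|lborel. (norm z)\<^sup>2)" by simp
  have sublevel: "z \<in> ?B \<longleftrightarrow> (norm z)\<^sup>2 < r\<^sup>2" for z
    using \<open>r > 0\<close> by (simp add: abs_le_square_iff flip: not_le)
  have integrable: "set_integrable lborel D (\<lambda>z. (norm z)\<^sup>2)" "set_integrable lborel ?B (\<lambda>z. (norm z)\<^sup>2)"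
    using D by (auto intro!: set_integrable_norm_power)
  note bathtub_minimizer_unique[OF fmeasurable[OF D(1,3)] fmeasurable[OF open_ball bounded_ball] measure_B
      integrable minimal sublevel]
  then have "negligible (D - ?B)" "negligible (?B - D)"
    by (simp_all add: negligible_iff_null_sets null_sets_completionI)
  with \<open>r > 0\<close> show ?thesis by (rule that)
qed

theorem theorem2:
  fixes D :: "complex set" and \<mu> :: real
  assumes "open D" and "D \<noteq> {}" and "connected D" and "bounded D" and "simply_connected D"
    and "C1_boundary D"
    and "barycenter_zero D"
    and "\<forall>x \<in> frontier D. stream_fun D x - (1/4) * (norm x)\<^sup>2 = \<mu>"
  shows "\<exists>c r. r > 0 \<and> D = ball c r"
proof -
  have "cauchy_transform (indicator D) z = of_real pi * cnj z" if "z \<in> D" for z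
    using cauchy_transform_eq_cnj_of_boundary_condition[OF assms(1,3,4) _ that] assms(8) by blast
  then obtain r where r: "r > 0" and null: "negligible (D - ball 0 r)" "negligible (ball 0 r - D)"
    by (rule negligible_diff_ball_of_cauchy_transform_eq[OF assms(1,2,4)])
  have "D \<subseteq> ball 0 r"
    using assms(1) null(1) frontier_ball_subset_closure_exterior[OF r]
    by (rule open_subset_of_negligible_diff)
  moreover have "ball 0 r \<subseteq> D"
    using open_ball null(2) C1_boundary_frontier_subset_closure_exterior[OF assms(6)]
    by (rule open_subset_of_negligible_diff)
  ultimately show ?thesis using r by blast
qed

end
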